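(* Let $S\subset\mathbb{Z}_{>0}$ be a finite nonempty set of positive integers and $m=\max(S)$. Then for every integer $n\ge m$, \[ D_S(n,q)=\sum_{k=0}^m b_k(S;q)\begin{bmatrix} n-k\\ m-k+1\end{bmatrix}_q, \] where $b_0(S;q)=0$ and for $k\ge1$, \[ b_k(S;q)=\sum_{\substack{\pi\in A(S;m+1)\\ \pi(m+1)=k}} q^{\ell(\pi)}\in\mathbb{R}_{\geq 0}[q]. \] Moreover, $(b_k(S;q))_{k=0,\ldots,m}$ is a strongly $q$-log concave sequence.
   Context: For $\pi=\pi_1\cdots\pi_n\in\mathfrak{S}_n$ in one-line notation, $\mathrm{Des}(\pi)=\{i\in[n-1]: \pi_i>\pi_{i+1}\}$ and $\ell(\pi)=|\{(i,j): 1\le i<j\le n,\ \pi_i>\pi_j\}|$. $A(S;n)=\{\pi\in\mathfrak{S}_n:\mathrm{Des}(\pi)=S\}$ and $D_S(n,q)=\sum_{\pi\in A(S;n)}q^{\ell(\pi)}$. $[k]_q=1+q+\cdots+q^{k-1}$, $[k]!_q=[1]_q\cdots[k]_q$, $\begin{bmatrix} n\\ k\end{bmatrix}_q=\frac{[n]!_q}{[n-k]!_q[k]!_q}$ for $0\le k\le n$, and $0$ if $k>n\ge0$. A sequence $(a_i(q))_{i=0,\ldots,k}$ in $\mathbb{R}_{\geq0}[q]$ is strongly $q$-log concave if it has no internal zeroes (if $a_i\neq0$, $a_{j'}\neq0$, $i<j<j'$, then $a_j\ne0$) and $a_i(q)a_j(q)-a_{i-1}(q)a_{j+1}(q)$ has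 nonnegative coefficients for all $i\le j$, with out-of-range terms taken as $0$. *)

theory Defs
  imports
    "HOL-Computational_Algebra.Polynomial"
    "HOL-Combinatorics.Permutations"
begin

text \<open>
  The indeterminate \<open>q\<close> is the variable of \<^typ>\<open>real poly\<close>. A permutation of \<open>[n]\<close> is a
  function \<open>\<pi>\<close> on \<^typ>\<open>nat\<close> with \<open>\<pi> permutes {1..n}\<close>; its one-line notation is \<open>\<pi> 1, \<dots>, \<pi> n\<close>.
\<close>

definition Des :: "nat \<Rightarrow> (nat \<Rightarrow> nat) \<Rightarrow> nat set" where
  "Des n \<pi> = {i. 1 \<le> i \<and> i < n \<and> \<pi> i > \<pi> (i + 1)}"

definition inv_number :: "nat \<Rightarrow> (nat \<Rightarrow> nat) \<Rightarrow> nat" where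
  "inv_number n \<pi> = card {(i, j). 1 \<le> i \<and> i < j \<and> j \<le> n \<and> \<pi> i > \<pi> j}"

definition descent_class :: "nat set \<Rightarrow> nat \<Rightarrow> (nat \<Rightarrow> nat) set" where
  "descent_class S n = {\<pi>. \<pi> permutes {1..n} \<and> Des n \<pi> = S}"

definition q_descent_poly :: "nat set \<Rightarrow> nat \<Rightarrow> real poly" where
  "q_descent_poly S n = (\<Sum>\<pi>\<in>descent_class S n. monom 1 (inv_number n \<pi>))"

definition q_int :: "nat \<Rightarrow> real poly" where
  "q_int k = (\<Sum>i<k. monom 1 i)"

definition q_fact :: "nat \<Rightarrow> real poly" where
  "q_fact k = (\<Prod>i=1..k. q_int i)"

text \<open>The polynomial division is exact; see \<open>q_binomial_mult\<close> below.\<close>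

definition q_binomial :: "nat \<Rightarrow> nat \<Rightarrow> real poly" where
  "q_binomial n k = (if k \<le> n then q_fact n div (q_fact (n - k) * q_fact k) else 0)"

definition nonneg_coeffs :: "real poly \<Rightarrow> bool" where
  "nonneg_coeffs p \<longleftrightarrow> (\<forall>i. coeff p i \<ge> 0)"

text \<open>Extension of \<open>a\<^sub>0, \<dots>, a\<^sub>k\<close> by \<open>0\<close> to all integer indices.\<close>

definition zero_extend :: "nat \<Rightarrow> (nat \<Rightarrow> real poly) \<Rightarrow> int \<Rightarrow> real poly" where
  "zero_extend k a i = (if 0 \<le> i \<and> i \<le> int k then a (nat i) else 0)"

definition no_internal_zeroes :: "nat \<Rightarrow> (nat \<Rightarrow> real poly) \<Rightarrow> bool" where
  "no_internal_zeroes k a \<longleftrightarrow>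
    (\<forall>i j j'. i < j \<and> j < j' \<and> j' \<le> k \<and> a i \<noteq> 0 \<and> a j' \<noteq> 0 \<longrightarrow> a j \<noteq> 0)"

definition strongly_q_log_concave :: "nat \<Rightarrow> (nat \<Rightarrow> real poly) \<Rightarrow> bool" where
  "strongly_q_log_concave k a \<longleftrightarrow>
    (\<forall>i\<le>k. nonneg_coeffs (a i)) \<and>
    no_internal_zeroes k a \<and>
    (\<forall>i j. i \<le> j \<longrightarrow>
      nonneg_coeffs (zero_extend k a i * zero_extend k a j
                     - zero_extend k a (i - 1) * zero_extend k a (j + 1)))"

definition b_poly :: "nat set \<Rightarrow> nat \<Rightarrow> real poly" where
  "b_poly S k = (if k = 0 then 0 else
    (\<Sum>\<pi> | \<pi> \<in> descent_class S (Max S + 1) \<and> \<pi> (Max S + 1) = k.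
       monom 1 (inv_number (Max S + 1) \<pi>)))"

lemma q_fact_0 [simp]: "q_fact 0 = 1"
  by (simp add: q_fact_def)

lemma q_fact_Suc: "q_fact (Suc n) = q_int (Suc n) * q_fact n"
  by (simp add: q_fact_def mult.commute)

lemma q_int_add: "q_int (a + b) = q_int a + monom 1 a * q_int b"
  by (induction b) (simp_all add: q_int_def algebra_simps mult_monom)

lemma q_int_nonzero: "k > 0 \<Longrightarrow> q_int k \<noteq> 0"
proof
  assume "k > 0" "q_int k = 0"
  then have "poly (q_int k) 1 = 0" by simp
  then have "real k = 0" by (simp add: q_int_def poly_sum poly_monom)
  with \<open>k > 0\<close> show False by simp
qed

lemma q_fact_nonzero: "q_fact k \<noteq> 0"
  by (auto simp: q_fact_def q_int_nonzero)

lemma q_fact_dvd: "q_fact a * q_fact b dvd q_fact (a + b)"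
proof (induction "a + b" arbitrary: a b)
  case 0
  then show ?case by simp
next
  case (Suc n)
  show ?case
  proof (cases "a = 0 \<or> b = 0")
    case True
    then show ?thesis by auto
  next
    case False
    then obtain a' b' where ab: "a = Suc a'" "b = Suc b'"
      by (metis not0_implies_Suc)
    have "q_fact a' * q_fact b dvd q_fact n" "q_fact a * q_fact b' dvd q_fact n"
      using Suc.hyps(1)[of a' b] Suc.hyps(1)[of a b'] Suc.hyps(2) ab by simp_all
    then obtain c d where c: "q_fact n = q_fact a' * q_fact b * c"
      and d: "q_fact n = q_fact a * q_fact b' * d"
      by (auto elim!: dvdE)
    have "q_fact (a + b) = q_int (a + b) * q_fact n"
      using Suc.hyps(2) by (metis q_fact_Suc)
    also have "\<dots> = q_int a * q_fact n + monom 1 a * q_int b * q_fact n"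
      by (simp add: q_int_add algebra_simps)
    also have "q_int a * q_fact n = q_fact a * q_fact b * c"
      unfolding c by (simp add: ab q_fact_Suc)
    also have "monom 1 a * q_int b * q_fact n = q_fact a * q_fact b * (monom 1 a * d)"
      unfolding d by (simp add: ab q_fact_Suc)
    finally have "q_fact (a + b) = q_fact a * q_fact b * (c + monom 1 a * d)"
      by (simp add: algebra_simps)
    then show ?thesis by simp
  qed
qed

lemma q_binomial_mult:
  assumes "k \<le> n"
  shows "q_binomial n k * (q_fact (n - k) * q_fact k) = q_fact n"
  using q_fact_dvd[of "n - k" k] assms by (simp add: q_binomial_def)

end

theory Submission
  imports Defs
begin

text \<open>
  Group the permutations of \<open>[n]\<close> with prescribed descents by their last value \<open>k\<close>. Deleting the
  last value and standardising shows that the resulting polynomials for \<open>n + 1\<close> are, up to a factor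
  \<open>q\<^bsup>n+1-k\<^esup>\<close>, initial sums (if \<open>n\<close> is an ascent) or final sums (if \<open>n\<close> is a descent) of those
  for \<open>n\<close>. Both kinds of partial sums preserve strong \<open>q\<close>-log concavity. Beyond \<open>m + 1\<close> only
  initial sums occur, and iterating them produces \<open>q\<close>-binomial coefficients by the
  \<open>q\<close>-Pascal rule.
\<close>

section \<open>Nonnegative coefficients\<close>

lemma nonneg_coeffs_0 [simp]: "nonneg_coeffs 0"
  by (simp add: nonneg_coeffs_def)

lemma nonneg_coeffs_monom_1 [simp]: "nonneg_coeffs (monom 1 n)"
  by (simp add: nonneg_coeffs_def)

lemma nonneg_coeffs_add: "nonneg_coeffs p \<Longrightarrow> nonneg_coeffs r \<Longrightarrow> nonneg_coeffs (p + r)"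
  by (simp add: nonneg_coeffs_def)

lemma nonneg_coeffs_mult: "nonneg_coeffs p \<Longrightarrow> nonneg_coeffs r \<Longrightarrow> nonneg_coeffs (p * r)"
  by (simp add: nonneg_coeffs_def coeff_mult sum_nonneg)

lemma nonneg_coeffs_sum: "(\<And>x. x \<in> A \<Longrightarrow> nonneg_coeffs (f x)) \<Longrightarrow> nonneg_coeffs (sum f A)"
  by (simp add: nonneg_coeffs_def coeff_sum sum_nonneg)

lemma nonneg_coeffs_sum_eq_0_iff:
  assumes "finite A" "\<And>x. x \<in> A \<Longrightarrow> nonneg_coeffs (f x)"
  shows "sum f A = 0 \<longleftrightarrow> (\<forall>x\<in>A. f x = 0)"
proof
  assume s: "sum f A = 0"
  show "\<forall>x\<in>A. f x = 0"
  proof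
    fix x assume x: "x \<in> A"
    have "coeff (f x) i = 0" for i
    proof -
      have "(\<Sum>x\<in>A. coeff (f x) i) = 0"
        using s by (metis coeff_0 coeff_sum)
      then show ?thesis
        using assms x by (subst (asm) sum_nonneg_eq_0_iff) (auto simp: nonneg_coeffs_def)
    qed
    then show "f x = 0" by (simp add: poly_eq_iff)
  qed
qed simp

lemma monom_1_add: "monom (1::real) (i + j) = monom 1 i * monom 1 j"
  by (simp add: mult_monom)

section \<open>Partial sums of log-concave sequences\<close>

text \<open>Infinite sequences with indices shifted up by one avoid natural subtraction and a length
  bound. Internal zeroes are treated separately.\<close>

definition slc :: "(nat \<Rightarrow> real poly) \<Rightarrow> bool" where
  "slc a \<longleftrightarrow> a 0 = 0 \<and> (\<forall>i. nonneg_coeffs (a i)) \<and>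
    (\<forall>i j. i \<le> j \<longrightarrow> nonneg_coeffs (a (i + 1) * a (j + 1) - a i * a (j + 2)))"

text \<open>Telescoping: moving the two indices apart by one is a single instance of
  \<open>slc\<close>, and the differences add up.\<close>

lemma slc_spread:
  assumes "slc a" "r \<le> s" "d \<le> r"
  shows "nonneg_coeffs (a r * a s - a (r - d) * a (s + d))"
  using assms(3)
proof (induction d)
  case 0
  then show ?case by simp
next
  case (Suc d)
  have le: "r - Suc d \<le> s + d - 1" using assms(2) by auto
  have "nonneg_coeffs (a (r - Suc d + 1) * a (s + d - 1 + 1) - a (r - Suc d) * a (s + d - 1 + 2))"
    using assms(1) le unfolding slc_def by blast
  moreover have "r - Suc d + 1 = r - d" "s + d - 1 + 1 = s + d" "s + d - 1 + 2 = s + Suc d"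
    using Suc.prems assms(2) by auto
  ultimately have "nonneg_coeffs (a (r - d) * a (s + d) - a (r - Suc d) * a (s + Suc d))"
    by metis
  from nonneg_coeffs_add[OF Suc.IH this] Suc.prems show ?case by simp
qed

lemma slc_inner_outer:
  assumes "slc a" "p \<le> r" "p \<le> s" "p + t = r + s"
  shows "nonneg_coeffs (a r * a s - a p * a t)"
proof (cases "r \<le> s")
  case True
  have "r - (r - p) = p" "s + (r - p) = t" using assms by auto
  then show ?thesis using slc_spread[of a r s "r - p"] assms True by simp
next
  case False
  have "s - (s - p) = p" "r + (s - p) = t" using assms by auto
  then show ?thesis using slc_spread[of a s r "s - p"] assms False by (simp add: mult.commute)
qed

lemma slc_nonneg: "slc a \<Longrightarrow> nonneg_coeffs (a i)"
  by (simp add: slc_def)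

text \<open>
  After cancellation, each term \<open>a\<^sub>t a\<^sub>j\<^sub>+\<^sub>1\<close> of the subtrahend is matched with the
  term of the minuend that has the same sum of indices.
\<close>

lemma initial_sums_log_concave:
  assumes a: "slc a" and ij: "i \<le> j"
  defines "A \<equiv> \<lambda>k. \<Sum>t<k. a t"
  shows "nonneg_coeffs (A (i + 1) * A (j + 1) - A i * A (j + 2))"
proof -
  \<comment> \<open>The last \<open>i\<close> terms of \<open>A (j + 1)\<close> are split off, so
    that \<open>a i * a (t + (j + 1 - i))\<close> meets \<open>a t * a (j + 1)\<close>, which has
    the same index sum.\<close>
  have "{..<j + 1} = {..<j + 1 - i} \<union> {j + 1 - i..<j + 1}" using ij by auto
  then have "A (j + 1) = (\<Sum>s<j + 1 - i. a s) + (\<Sum>s=j + 1 - i..<j + 1. a s)"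
    unfolding A_def by (metis (no_types, lifting) finite_lessThan finite_atLeastLessThan
        ivl_disj_int_one(2) sum.union_disjoint)
  moreover have "(\<Sum>s=j + 1 - i..<j + 1. a s) = (\<Sum>t<i. a (t + (j + 1 - i)))"
    using ij by (intro sum.reindex_bij_witness[of _ "\<lambda>t. t + (j + 1 - i)" "\<lambda>s. s - (j + 1 - i)"]) auto
  moreover have "A (i + 1) * A (j + 1) - A i * A (j + 2) = a i * A (j + 1) - A i * a (j + 1)"
    by (simp add: A_def algebra_simps)
  ultimately have "A (i + 1) * A (j + 1) - A i * A (j + 2) =
      a i * (\<Sum>s<j + 1 - i. a s) + (\<Sum>t<i. a i * a (t + (j + 1 - i)) - a t * a (j + 1))"
    by (simp add: A_def algebra_simps sum_distrib_left sum_subtractf)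
  moreover have "nonneg_coeffs (a i * (\<Sum>s<j + 1 - i. a s))"
    by (intro nonneg_coeffs_mult nonneg_coeffs_sum slc_nonneg[OF a])
  moreover have "nonneg_coeffs (\<Sum>t<i. a i * a (t + (j + 1 - i)) - a t * a (j + 1))"
    using ij by (intro nonneg_coeffs_sum slc_inner_outer[OF a]) auto
  ultimately show ?thesis by (simp add: nonneg_coeffs_add)
qed

text \<open>Mirror image of the initial sums: each \<open>a i * a t\<close> with
  \<open>t \<ge> j + 2\<close> is absorbed by
  \<open>a (j + 1) * a (t - (j + 1 - i))\<close>.\<close>

lemma final_sums_log_concave:
  assumes a: "slc a" and ij: "i \<le> j" and jn: "j + 1 \<le> n"
  defines "B \<equiv> \<lambda>k. \<Sum>t=k..n. a t"
  shows "nonneg_coeffs (B (i + 1) * B (j + 1) - B i * B (j + 2))"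
proof -
  \<comment> \<open>Chosen so that \<open>{i + 1..e}\<close> is \<open>{j + 2..n}\<close> translated
    down by \<open>j + 1 - i\<close>.\<close>
  define e where "e = n - (j + 1 - i)"
  have "{i + 1..n} = {i + 1..e} \<union> {e<..n}" "{i + 1..e} \<inter> {e<..n} = {}"
    using ij jn by (auto simp: e_def)
  then have "B (i + 1) = (\<Sum>s=i + 1..e. a s) + (\<Sum>s\<in>{e<..n}. a s)"
    unfolding B_def by (metis finite_atLeastAtMost finite_greaterThanAtMost sum.union_disjoint)
  moreover have "(\<Sum>s=i + 1..e. a s) = (\<Sum>t=j + 2..n. a (t - (j + 1 - i)))"
    using ij jn by (intro sum.reindex_bij_witness[of _ "\<lambda>t. t - (j + 1 - i)" "\<lambda>s. s + (j + 1 - i)"])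
      (auto simp: e_def)
  moreover have "B i = a i + B (i + 1)" "B (j + 1) = a (j + 1) + B (j + 2)"
    unfolding B_def using ij jn by (auto simp: sum.atLeast_Suc_atMost)
  then have "B (i + 1) * B (j + 1) - B i * B (j + 2) = a (j + 1) * B (i + 1) - a i * B (j + 2)"
    by (simp add: algebra_simps)
  ultimately have "B (i + 1) * B (j + 1) - B i * B (j + 2) =
      a (j + 1) * (\<Sum>s\<in>{e<..n}. a s) +
      (\<Sum>t=j + 2..n. a (j + 1) * a (t - (j + 1 - i)) - a i * a t)"
    by (simp add: B_def algebra_simps sum_distrib_left sum_subtractf)
  moreover have "nonneg_coeffs (a (j + 1) * (\<Sum>s\<in>{e<..n}. a s))"
    by (intro nonneg_coeffs_mult nonneg_coeffs_sum slc_nonneg[OF a])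
  moreover have "nonneg_coeffs (\<Sum>t=j + 2..n. a (j + 1) * a (t - (j + 1 - i)) - a i * a t)"
    using ij by (intro nonneg_coeffs_sum slc_inner_outer[OF a]) auto
  ultimately show ?thesis by (simp add: nonneg_coeffs_add)
qed

text \<open>The exponent \<open>n + 1 - k\<close> is affine in \<open>k\<close>, so both products
  carry the same power of q, which factors out.\<close>

lemma slc_truncate_shift:
  assumes nn: "\<And>k. nonneg_coeffs (A k)"
    and lc: "\<And>i j. i \<le> j \<Longrightarrow> j + 1 \<le> n \<Longrightarrow>
      nonneg_coeffs (A (i + 1) * A (j + 1) - A i * A (j + 2))"
  shows "slc (\<lambda>k. if 1 \<le> k \<and> k \<le> n + 1 then monom 1 (n + 1 - k) * A k else 0)"
    (is "slc ?F")
  unfolding slc_def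
proof (intro conjI allI impI)
  show nF: "nonneg_coeffs (?F i)" for i by (simp add: nn nonneg_coeffs_mult)
  fix i j :: nat assume ij: "i \<le> j"
  show "nonneg_coeffs (?F (i + 1) * ?F (j + 1) - ?F i * ?F (j + 2))"
  proof (cases "1 \<le> i \<and> j + 1 \<le> n")
    case True
    have e: "n + 1 - i + (n + 1 - (j + 2)) = n + 1 - (i + 1) + (n + 1 - (j + 1))"
      using True ij by auto
    have "?F (i + 1) * ?F (j + 1) =
        monom 1 (n + 1 - (i + 1) + (n + 1 - (j + 1))) * (A (i + 1) * A (j + 1))"
      unfolding monom_1_add using True ij by simp
    moreover have "?F i * ?F (j + 2) = monom 1 (n + 1 - i + (n + 1 - (j + 2))) * (A i * A (j + 2))"
      unfolding monom_1_add using True ij by simp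
    ultimately have "?F (i + 1) * ?F (j + 1) - ?F i * ?F (j + 2) =
        monom 1 (n + 1 - (i + 1) + (n + 1 - (j + 1))) * (A (i + 1) * A (j + 1) - A i * A (j + 2))"
      by (metis e right_diff_distrib)
    then show ?thesis using lc[OF ij] True by (simp only: nonneg_coeffs_mult nonneg_coeffs_monom_1)
  next
    case False
    \<comment> \<open>Either \<open>i = 0\<close> or \<open>j + 2 > n + 1\<close>, so truncation
      kills the subtrahend.\<close>
    then have "?F i * ?F (j + 2) = 0" by auto
    then show ?thesis using nonneg_coeffs_mult[OF nF nF] by (metis diff_zero)
  qed
qed simp

section \<open>Permutations by their last value\<close>

text \<open>Cutting \<open>S\<close> down to \<open>{1..<n}\<close> lets one fixed \<open>S\<close>
  serve for all \<open>n\<close> in the recursion.\<close>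

definition last_class :: "nat set \<Rightarrow> nat \<Rightarrow> nat \<Rightarrow> (nat \<Rightarrow> nat) set" where
  "last_class S n k = {\<pi>. \<pi> permutes {1..n} \<and> Des n \<pi> = S \<inter> {1..<n} \<and> \<pi> n = k}"

definition last_poly :: "nat set \<Rightarrow> nat \<Rightarrow> nat \<Rightarrow> real poly" where
  "last_poly S n k = (\<Sum>\<pi>\<in>last_class S n k. monom 1 (inv_number n \<pi>))"

lemma finite_last_class: "finite (last_class S n k)"
  by (rule finite_subset[OF _ finite_permutations[of "{1..n}"]]) (auto simp: last_class_def)

lemma last_class_empty: "1 \<le> n \<Longrightarrow> k \<notin> {1..n} \<Longrightarrow> last_class S n k = {}"
  by (auto simp: last_class_def) (metis atLeastAtMost_iff order_refl permutes_in_image One_nat_def)+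

lemma last_poly_outside: "1 \<le> n \<Longrightarrow> k \<notin> {1..n} \<Longrightarrow> last_poly S n k = 0"
  by (simp add: last_poly_def last_class_empty)

lemma last_poly_nonneg: "nonneg_coeffs (last_poly S n k)"
  unfolding last_poly_def by (intro nonneg_coeffs_sum) simp

text \<open>The cycle that inserts a new last value \<open>k\<close> by composition from the left.\<close>

definition ins :: "nat \<Rightarrow> nat \<Rightarrow> nat \<Rightarrow> nat" where
  "ins n k i = (if i = n + 1 then k else if k \<le> i \<and> i \<le> n then i + 1 else i)"

lemma ins_permutes:
  assumes "k \<in> {1..n + 1}" shows "ins n k permutes {1..n + 1}"
proof (rule bij_imp_permutes)
  show "bij_betw (ins n k) {1..n + 1} {1..n + 1}"
    by (rule bij_betw_byWitness[where f' = "\<lambda>i. if i = k then n + 1 else if i > k then i - 1 else i"])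
      (use assms in \<open>auto simp: ins_def\<close>)
qed (use assms in \<open>auto simp: ins_def\<close>)

lemma ins_less_iff: "i \<in> {1..n} \<Longrightarrow> j \<in> {1..n} \<Longrightarrow> ins n k i < ins n k j \<longleftrightarrow> i < j"
  by (auto simp: ins_def)

lemma less_ins_iff: "i \<in> {1..n} \<Longrightarrow> k < ins n k i \<longleftrightarrow> k \<le> i"
  by (auto simp: ins_def)

lemma permutes_range: "\<pi> permutes {1..n} \<Longrightarrow> 1 \<le> i \<Longrightarrow> i \<le> n \<Longrightarrow> \<pi> i \<in> {1..n}"
  by (simp only: permutes_in_image) simp

lemma ins_comp_last: "\<pi> permutes {1..n} \<Longrightarrow> (ins n k \<circ> \<pi>) (n + 1) = k"
  by (simp add: ins_def permutes_not_in)

text \<open>\<open>ins n k\<close> is increasing on \<open>{1..n}\<close>, so old comparisons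
  survive; only the comparison with the new last value \<open>k\<close> is added.\<close>

lemma Des_ins_comp:
  assumes "\<pi> permutes {1..n}" "1 \<le> n"
  shows "Des (n + 1) (ins n k \<circ> \<pi>) = Des n \<pi> \<union> (if k \<le> \<pi> n then {n} else {})"
proof -
  have "i \<in> Des (n + 1) (ins n k \<circ> \<pi>) \<longleftrightarrow> i \<in> Des n \<pi> \<union> (if k \<le> \<pi> n then {n} else {})" for i
  proof (cases "i = n")
    case True
    then show ?thesis
      using ins_comp_last[OF assms(1), of k] less_ins_iff[OF permutes_range[OF assms(1), of n], of k]
        assms(2) by (auto simp: Des_def)
  next
    case False
    then show ?thesis
      using ins_less_iff[OF permutes_range[OF assms(1), of "i + 1"] permutes_range[OF assms(1), of i], of k]
      by (auto simp: Des_def)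
  qed
  then show ?thesis by blast
qed

text \<open>The new inversions pair position \<open>n + 1\<close> with the positions whose old
  values lie in \<open>{k..n}\<close>.\<close>

lemma inv_number_ins_comp:
  assumes p: "\<pi> permutes {1..n}" and k: "k \<in> {1..n + 1}"
  shows "inv_number (n + 1) (ins n k \<circ> \<pi>) = inv_number n \<pi> + (n + 1 - k)"
proof -
  let ?I = "{(i, j). 1 \<le> i \<and> i < j \<and> j \<le> n \<and> \<pi> i > \<pi> j}"
  let ?K = "{i \<in> {1..n}. k \<le> \<pi> i}"
  have "(i, j) \<in> {(i, j). 1 \<le> i \<and> i < j \<and> j \<le> n + 1 \<and> (ins n k \<circ> \<pi>) i > (ins n k \<circ> \<pi>) j}
      \<longleftrightarrow> (i, j) \<in> ?I \<union> (\<lambda>i. (i, n + 1)) ` ?K" for i j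
  proof (cases "j = n + 1")
    case True
    then show ?thesis
      using ins_comp_last[OF p, of k] less_ins_iff[OF permutes_range[OF p, of i], of k] by auto
  next
    case False
    then show ?thesis
      using ins_less_iff[OF permutes_range[OF p, of j] permutes_range[OF p, of i], of k] by auto
  qed
  then have "{(i, j). 1 \<le> i \<and> i < j \<and> j \<le> n + 1 \<and> (ins n k \<circ> \<pi>) i > (ins n k \<circ> \<pi>) j}
      = ?I \<union> (\<lambda>i. (i, n + 1)) ` ?K" by auto
  moreover have "finite ?I"
    by (rule finite_subset[of _ "{1..n} \<times> {1..n}"]) auto
  moreover have "?I \<inter> (\<lambda>i. (i, n + 1)) ` ?K = {}" by auto
  ultimately have "inv_number (n + 1) (ins n k \<circ> \<pi>) = inv_number n \<pi> + card ?K"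
    by (simp add: inv_number_def card_Un_disjoint card_image inj_on_def)
  moreover have "\<pi> ` ?K = {k..n}"
  proof (intro equalityI subsetI)
    fix x assume "x \<in> {k..n}"
    then have "x \<in> \<pi> ` {1..n}" using permutes_image[OF p] k by auto
    then show "x \<in> \<pi> ` ?K" using \<open>x \<in> {k..n}\<close> by auto
  qed (use permutes_range[OF p] in auto)
  then have "card ?K = n + 1 - k"
    using card_image[of \<pi> ?K] inj_on_subset[OF permutes_inj[OF p]] by (metis card_atLeastAtMost
        Suc_eq_plus1 subset_UNIV)
  ultimately show ?thesis by simp
qed

text \<open>Position \<open>n\<close> becomes a descent exactly when the old last value is at least
  \<open>k\<close>; membership of \<open>n\<close> in \<open>S\<close> thus selects the range of old
  last values.\<close>

lemma last_class_Suc: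
  assumes n: "1 \<le> n" and k: "k \<in> {1..n + 1}"
  shows "last_class S (n + 1) k =
    (\<lambda>\<pi>. ins n k \<circ> \<pi>) ` (\<Union>j\<in>(if n \<in> S then {k..n} else {1..<k}). last_class S n j)"
    (is "_ = ?f ` ?U")
proof (intro equalityI subsetI)
  have Des_iff: "Des (n + 1) (?f \<pi>) = S \<inter> {1..<n + 1} \<longleftrightarrow>
      Des n \<pi> = S \<inter> {1..<n} \<and> (n \<in> S \<longleftrightarrow> k \<le> \<pi> n)" if "\<pi> permutes {1..n}" for \<pi>
  proof -
    have "S \<inter> {1..<n + 1} = S \<inter> {1..<n} \<union> (if n \<in> S then {n} else {})"
      using n by (auto simp: less_Suc_eq)
    moreover have "n \<notin> Des n \<pi>" by (simp add: Des_def)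
    moreover have "n \<notin> S \<inter> {1..<n}" by simp
    ultimately show ?thesis unfolding Des_ins_comp[OF that n]
      by (auto split: if_splits)
  qed
  note insp = ins_permutes[OF k]
  fix \<pi>
  {
    assume "\<pi> \<in> ?f ` ?U"
    then obtain \<sigma> where \<sigma>: "\<pi> = ?f \<sigma>" "\<sigma> permutes {1..n}" "Des n \<sigma> = S \<inter> {1..<n}"
      "n \<in> S \<longleftrightarrow> k \<le> \<sigma> n"
      by (auto simp: last_class_def split: if_splits)
    have "\<sigma> permutes {1..n + 1}"
      by (rule permutes_subset[OF \<sigma>(2)]) auto
    then have "\<pi> permutes {1..n + 1}" using \<sigma>(1) permutes_compose[OF _ insp] by simp
    then show "\<pi> \<in> last_class S (n + 1) k"
      using \<sigma> Des_iff[of \<sigma>] ins_comp_last[OF \<sigma>(2), of k] unfolding last_class_def by simp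
  }
  assume "\<pi> \<in> last_class S (n + 1) k"
  then have \<pi>: "\<pi> permutes {1..n + 1}" "Des (n + 1) \<pi> = S \<inter> {1..<n + 1}" "\<pi> (n + 1) = k"
    by (auto simp: last_class_def)
  \<comment> \<open>Undoing the insertion fixes \<open>n + 1\<close>, hence leaves a permutation of
    \<open>{1..n}\<close>.\<close>
  define \<sigma> where "\<sigma> = inv (ins n k) \<circ> \<pi>"
  have eq: "\<pi> = ?f \<sigma>"
    unfolding \<sigma>_def by (simp add: o_assoc permutes_inv_o[OF insp])
  have "\<sigma> (n + 1) = n + 1"
    unfolding \<sigma>_def using \<pi>(3) by (simp add: permutes_inverses[OF insp] permutes_inv_eq[OF insp] ins_def)
  moreover have "\<sigma> permutes {1..n + 1}"
    unfolding \<sigma>_def by (rule permutes_compose[OF \<pi>(1) permutes_inv[OF insp]])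
  ultimately have \<sigma>: "\<sigma> permutes {1..n}"
    by (elim permutes_superset) (auto simp: le_Suc_eq)
  have "\<sigma> n \<in> {1..n}" using permutes_range[OF \<sigma>] n by simp
  then have "\<sigma> \<in> ?U"
    using Des_iff[OF \<sigma>] \<pi>(2) \<sigma> unfolding eq last_class_def by (auto simp: not_le)
  then show "\<pi> \<in> ?f ` ?U" using eq by blast
qed

lemma last_poly_Suc:
  assumes n: "1 \<le> n" and k: "k \<in> {1..n + 1}"
  shows "last_poly S (n + 1) k =
    monom 1 (n + 1 - k) * (\<Sum>j\<in>(if n \<in> S then {k..n} else {1..<k}). last_poly S n j)"
proof -
  let ?J = "if n \<in> S then {k..n} else {1..<k}"
  let ?U = "\<Union>j\<in>?J. last_class S n j"
  have "inj_on (\<lambda>\<pi>. ins n k \<circ> \<pi>) ?U"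
    by (rule inj_onI) (metis fun.inj_map_strong injD permutes_inj[OF ins_permutes[OF k]])
  then have "last_poly S (n + 1) k = (\<Sum>\<pi>\<in>?U. monom 1 (inv_number (n + 1) (ins n k \<circ> \<pi>)))"
    unfolding last_poly_def last_class_Suc[OF n k] by (subst sum.reindex) simp_all
  also have "\<dots> = (\<Sum>\<pi>\<in>?U. monom 1 (n + 1 - k) * monom 1 (inv_number n \<pi>))"
    by (intro sum.cong refl, subst inv_number_ins_comp[OF _ k])
      (auto simp: last_class_def mult_monom add.commute split: if_splits)
  also have "\<dots> = monom 1 (n + 1 - k) * (\<Sum>\<pi>\<in>?U. monom 1 (inv_number n \<pi>))"
    by (simp add: sum_distrib_left)
  also have "(\<Sum>\<pi>\<in>?U. monom 1 (inv_number n \<pi>)) = (\<Sum>j\<in>?J. last_poly S n j)"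
    unfolding last_poly_def
    by (rule sum.UNION_disjoint) (auto simp: finite_last_class, auto simp: last_class_def)
  finally show ?thesis .
qed

lemma last_poly_1: "last_poly S 1 k = (if k = 1 then 1 else 0)"
proof -
  have "last_class S 1 k = (if k = 1 then {id} else {})"
    by (auto simp: last_class_def Des_def)
  moreover have "{(i::nat, j). 1 \<le> i \<and> i < j \<and> j \<le> 1 \<and> id i > id j} = {}" by auto
  then have "inv_number 1 id = 0" unfolding inv_number_def by (simp only: card.empty)
  ultimately show ?thesis by (simp add: last_poly_def)
qed

section \<open>Log-concavity and internal zeroes of the polynomials by last value\<close>

lemma slc_last_poly:
  assumes "1 \<le> n" shows "slc (last_poly S n)"
  using assms
proof (induction n rule: dec_induct)
  case base
  show ?case by (auto simp: slc_def last_poly_1[unfolded One_nat_def] nonneg_coeffs_def)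
next
  case (step n)
  define A where "A = (\<lambda>k. if n \<in> S then \<Sum>j=k..n. last_poly S n j else \<Sum>j<k. last_poly S n j)"
  \<comment> \<open>The term at 0 vanishes, which brings the recursion into the form of the initial
    sums studied above.\<close>
  have s: "(\<Sum>j=1..<k. last_poly S n j) = (\<Sum>j<k. last_poly S n j)" for k
    using last_poly_outside[of n] step.hyps by (intro sum.mono_neutral_left) auto
  have "last_poly S (n + 1) = (\<lambda>k. if 1 \<le> k \<and> k \<le> n + 1 then monom 1 (n + 1 - k) * A k else 0)"
    using last_poly_Suc[of n _ S] last_poly_outside[of "n + 1" _ S] s step.hyps
    by (auto simp: A_def fun_eq_iff)
  moreover have "slc \<dots>"
  proof (rule slc_truncate_shift)
    show "nonneg_coeffs (A k)" for k
      by (auto simp: A_def intro!: nonneg_coeffs_sum last_poly_nonneg)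
    fix i j assume "i \<le> j" "j + 1 \<le> n"
    then show "nonneg_coeffs (A (i + 1) * A (j + 1) - A i * A (j + 2))"
      using initial_sums_log_concave[OF step.IH] final_sums_log_concave[OF step.IH]
      unfolding A_def by (cases "n \<in> S") (simp_all only: if_True if_False)
  qed
  ultimately show ?case by simp
qed

text \<open>Nonnegativity excludes cancellation, so a sum is nonzero iff one of its terms is. The
  summation ranges are monotone in \<open>k\<close>, so the range for \<open>j\<close> contains that
  for \<open>i\<close> or that for \<open>l\<close>.\<close>

lemma last_poly_no_internal_zeroes:
  assumes n: "1 \<le> n" and ij: "i < j" "j < l"
    and nz: "last_poly S (n + 1) i \<noteq> 0" "last_poly S (n + 1) l \<noteq> 0"
  shows "last_poly S (n + 1) j \<noteq> 0"
proof -
  let ?J = "\<lambda>k. if n \<in> S then {k..n} else {1..<k}"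
  have il: "i \<in> {1..n + 1}" "l \<in> {1..n + 1}"
    using nz last_poly_outside[of "n + 1"] by auto
  then have j: "j \<in> {1..n + 1}" using ij by auto
  have nz_iff: "last_poly S (n + 1) k \<noteq> 0 \<longleftrightarrow> (\<exists>t\<in>?J k. last_poly S n t \<noteq> 0)"
    if "k \<in> {1..n + 1}" for k
    unfolding last_poly_Suc[OF n that]
    by (subst mult_eq_0_iff, subst nonneg_coeffs_sum_eq_0_iff) (auto simp: last_poly_nonneg)
  have "?J i \<subseteq> ?J j \<or> ?J l \<subseteq> ?J j" using ij by auto
  then show ?thesis
    using nz nz_iff[OF j] nz_iff[OF il(1)] nz_iff[OF il(2)] by blast
qed

section \<open>Iterated initial sums\<close>

text \<open>Cancelling the nonzero q-factorials replaces any computation with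
  \<open>div\<close>.\<close>

lemma q_binomial_unique:
  assumes "k \<le> n" "p * (q_fact (n - k) * q_fact k) = q_fact n"
  shows "q_binomial n k = p"
  using q_binomial_mult[OF assms(1)] assms(2) q_fact_nonzero
  by (metis mult_cancel_right mult_eq_0_iff)

lemma q_binomial_0 [simp]: "q_binomial n 0 = 1"
  by (rule q_binomial_unique) auto

lemma q_binomial_self [simp]: "q_binomial n n = 1"
  by (rule q_binomial_unique) auto

lemma q_binomial_symmetric: "k \<le> n \<Longrightarrow> q_binomial n (n - k) = q_binomial n k"
  by (simp add: q_binomial_def mult.commute)

text \<open>Over a common denominator this is \<open>q_int_add\<close> for the splitting of
  \<open>n + 1\<close> into \<open>k + 1\<close> and \<open>n - k\<close>.\<close>

lemma q_binomial_Suc_Suc: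
  "q_binomial (Suc n) (Suc k) = q_binomial n k + monom 1 (Suc k) * q_binomial n (Suc k)"
proof (cases "Suc k \<le> n")
  case True
  show ?thesis
  proof (rule q_binomial_unique)
    define d where "d = n - Suc k"
    have d: "n - k = Suc d" "Suc n = Suc k + Suc d" using True by (auto simp: d_def)
    have b: "q_binomial n k * (q_fact (n - k) * q_fact k) = q_fact n"
      "q_binomial n (Suc k) * (q_fact d * q_fact (Suc k)) = q_fact n"
      using q_binomial_mult[of k n] q_binomial_mult[of "Suc k" n] True by (auto simp: d_def)
    have "(q_binomial n k + monom 1 (Suc k) * q_binomial n (Suc k)) *
        (q_fact (n - k) * q_fact (Suc k)) =
      q_int (Suc k) * (q_binomial n k * (q_fact (n - k) * q_fact k)) +
      monom 1 (Suc k) * (q_int (Suc d) * (q_binomial n (Suc k) * (q_fact d * q_fact (Suc k))))"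
      unfolding d q_fact_Suc by (simp add: algebra_simps)
    also have "\<dots> =
      q_int (Suc k) * q_fact n + monom 1 (Suc k) * (q_int (Suc d) * q_fact n)"
      unfolding b ..
    also have "\<dots> = q_fact (Suc n)"
      using q_int_add[of "Suc k" "Suc d"] unfolding q_fact_Suc d(2)[symmetric]
      by (simp add: algebra_simps)
    finally show "(q_binomial n k + monom 1 (Suc k) * q_binomial n (Suc k)) *
        (q_fact (Suc n - Suc k) * q_fact (Suc k)) = q_fact (Suc n)" by simp
  qed (use True in simp)
next
  case False
  then show ?thesis by (cases "k = n") (auto simp: q_binomial_def[of n "Suc n"], auto simp: q_binomial_def)
qed

text \<open>
  Partial sums up to \<open>l\<close>, rather than single terms, give a closed form that is also valid for
  \<open>r = 0\<close>.
\<close>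

lemma initial_sum_last_poly:
  assumes "1 \<le> M" "\<forall>s\<in>S. s < M" "l \<le> M + r"
  shows "(\<Sum>k\<le>l. last_poly S (M + r) k) =
    (\<Sum>k\<le>l. last_poly S M k * (monom 1 (r * (M + r - l)) * q_binomial (l - k) r))"
  using assms(3)
proof (induction r arbitrary: l)
  case 0
  show ?case by (simp flip: one_pCons add: monom_0)
next
  case (Suc r)
  let ?f = "last_poly S" and ?N = "M + Suc r"
  \<comment> \<open>The inner induction appends one term at a time; the recursion turns that term
    into a partial sum at level \<open>r\<close>, known from the outer hypothesis.\<close>
  show ?case using Suc.prems
  proof (induction l)
    case 0
    then show ?case using assms(1) last_poly_outside[of ?N 0 S] last_poly_outside[of M 0 S] by simp
  next
    case (Suc l)
    have rec: "?f ?N (Suc l) = monom 1 (?N - Suc l) * (\<Sum>k\<le>l. ?f (M + r) k)"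
    proof -
      have "M + r \<notin> S" using assms(2) by auto
      then have "?f ?N (Suc l) = monom 1 (?N - Suc l) * (\<Sum>k=1..<Suc l. ?f (M + r) k)"
        using last_poly_Suc[of "M + r" "Suc l" S] Suc.prems assms(1) by simp
      also have "(\<Sum>k=1..<Suc l. ?f (M + r) k) = (\<Sum>k\<le>l. ?f (M + r) k)"
        using last_poly_outside[of "M + r" 0 S] assms(1)
        by (intro sum.mono_neutral_left) (auto simp: not_le less_Suc_eq_le)
      finally show ?thesis .
    qed
    have l: "l \<le> M + r" using Suc.prems by simp
    define e where "e = M + r - l"
    have e: "?N - Suc l = e" "?N - l = Suc e" "M + r - l = e" using l by (auto simp: e_def)
    \<comment> \<open>This is the q-Pascal rule; raising \<open>e\<close> to \<open>Suc e\<close>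
      supplies its factor \<open>monom 1 (Suc r)\<close>.\<close>
    have term_eq: "?f M k * (monom 1 (Suc r * e) * q_binomial (Suc l - k) (Suc r)) =
        ?f M k * (monom 1 (Suc r * Suc e) * q_binomial (l - k) (Suc r)) +
        monom 1 e * (?f M k * (monom 1 (r * e) * q_binomial (l - k) r))" if "k \<le> l" for k
    proof -
      have "monom (1::real) (Suc r * Suc e) = monom 1 (Suc r * e) * monom 1 (Suc r)"
        "monom (1::real) (Suc r * e) = monom 1 e * monom 1 (r * e)"
        by (simp_all add: mult_monom algebra_simps)
      then show ?thesis
        unfolding Suc_diff_le[OF that] q_binomial_Suc_Suc by (simp add: algebra_simps)
    qed
    have "(\<Sum>k\<le>Suc l. ?f ?N k) = (\<Sum>k\<le>l. ?f ?N k) + ?f ?N (Suc l)" by simp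
    also have "\<dots> = (\<Sum>k\<le>l. ?f M k * (monom 1 (Suc r * Suc e) * q_binomial (l - k) (Suc r))) +
        monom 1 e * (\<Sum>k\<le>l. ?f M k * (monom 1 (r * e) * q_binomial (l - k) r))"
      using Suc.IH Suc.prems \<open>\<And>l. l \<le> M + r \<Longrightarrow> _\<close>[OF l] unfolding rec e by simp
    also have "\<dots> = (\<Sum>k\<le>l. ?f M k * (monom 1 (Suc r * e) * q_binomial (Suc l - k) (Suc r)))"
      unfolding sum_distrib_left sum.distrib[symmetric]
      by (intro sum.cong refl) (simp only: term_eq atMost_iff)
    \<comment> \<open>The extra term contains \<open>q_binomial 0 (Suc r)\<close>, which is 0 by
      default.\<close>
    also have "\<dots> = (\<Sum>k\<le>Suc l. ?f M k * (monom 1 (Suc r * e) * q_binomial (Suc l - k) (Suc r)))"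
      by (simp add: q_binomial_def)
    finally show ?case unfolding e .
  qed
qed

section \<open>Descent polynomials and \<open>b_poly\<close> in terms of last values\<close>

lemma b_poly_eq_last_poly:
  assumes "finite S" "\<forall>s\<in>S. s > 0"
  shows "b_poly S k = last_poly S (Max S + 1) k"
proof (cases "k = 0")
  case True
  then show ?thesis by (simp add: b_poly_def last_poly_outside)
next
  case False
  have "S \<inter> {1..<Max S + 1} = S"
    using assms by (auto simp: less_Suc_eq_le Suc_le_eq)
  then have "last_class S (Max S + 1) k =
      {\<pi> \<in> descent_class S (Max S + 1). \<pi> (Max S + 1) = k}"
    unfolding last_class_def descent_class_def by auto
  then show ?thesis using False by (simp add: b_poly_def last_poly_def)
qed

lemma q_descent_poly_eq_sum_last_poly:
  assumes "S \<subseteq> {1..<n}" "1 \<le> n"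
  shows "q_descent_poly S n = (\<Sum>k\<le>n. last_poly S n k)"
proof -
  have "S \<inter> {1..<n} = S" using assms(1) by auto
  then have "descent_class S n = (\<Union>k\<in>{..n}. last_class S n k)"
    using permutes_range[of _ n n] assms(2) by (auto simp: descent_class_def last_class_def)
  then show ?thesis
    unfolding q_descent_poly_def last_poly_def
    by (simp only:) (rule sum.UNION_disjoint, auto simp: finite_last_class, auto simp: last_class_def)
qed

theorem theorem2p2:
  fixes S :: "nat set" and m :: nat
  assumes "finite S" and "S \<noteq> {}" and "\<forall>s\<in>S. s > 0"
    and "m = Max S"
  shows "(\<forall>n\<ge>m. q_descent_poly S n =
            (\<Sum>k=0..m. b_poly S k * q_binomial (n - k) (m - k + 1)))
       \<and> (\<forall>k\<ge>1. nonneg_coeffs (b_poly S k))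
       \<and> strongly_q_log_concave m (b_poly S)"
proof -
  have b: "b_poly S = last_poly S (m + 1)"
    using b_poly_eq_last_poly[OF assms(1,3)] assms(4) by auto
  have mS: "m \<in> S" using assms by simp
  have m: "1 \<le> m" using mS assms(3) by (simp add: Suc_le_eq)
  have S: "\<forall>s\<in>S. s < m + 1" "S \<subseteq> {1..m}" using assms by (auto simp: less_Suc_eq_le Suc_le_eq)
  \<comment> \<open>A descent at \<open>m\<close> forbids the largest value in the last position;
    the recursion sums over the empty range \<open>{m + 1..m}\<close>.\<close>
  have b_top: "b_poly S (m + 1) = 0"
    using last_poly_Suc[of m "m + 1" S] m mS b by simp
  have "q_descent_poly S n = (\<Sum>k=0..m. b_poly S k * q_binomial (n - k) (m - k + 1))"
    if n: "n \<ge> m" for n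
  proof (cases "n = m")
    case True
    \<comment> \<open>No permutation of \<open>{1..m}\<close> has a descent at \<open>m\<close>, and
      each binomial on the right has lower index one above the upper one.\<close>
    have "descent_class S m = {}" using mS by (auto simp: descent_class_def Des_def)
    then show ?thesis using True by (auto simp: q_descent_poly_def q_binomial_def intro!: sum.neutral)
  next
    case False
    define r where "r = n - (m + 1)"
    have r: "n = m + 1 + r" using False n by (simp add: r_def)
    have "q_descent_poly S n = (\<Sum>k\<le>n. last_poly S n k)"
      using S m r by (intro q_descent_poly_eq_sum_last_poly) auto
    also have "\<dots> = (\<Sum>k\<le>n. b_poly S k * q_binomial (n - k) r)"
      \<comment> \<open>At \<open>l = n\<close> the exponent \<open>r * (M + r - l)\<close> is 0, so
        the power of q disappears.\<close>
      using initial_sum_last_poly[of "m + 1" S n r] S(1) r b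
      by (simp flip: one_pCons add: monom_0)
    also have "\<dots> = (\<Sum>k=0..m. b_poly S k * q_binomial (n - k) r)"
    proof (rule sum.mono_neutral_right)
      show "\<forall>k\<in>{..n} - {0..m}. b_poly S k * q_binomial (n - k) r = 0"
      proof
        fix k assume "k \<in> {..n} - {0..m}"
        then show "b_poly S k * q_binomial (n - k) r = 0"
          using b_top last_poly_outside[of "m + 1" k S] b by (cases "k = m + 1") auto
      qed
    qed (use n in auto)
    also have "\<dots> = (\<Sum>k=0..m. b_poly S k * q_binomial (n - k) (m - k + 1))"
    proof (rule sum.cong)
      fix k assume "k \<in> {0..m}"
      \<comment> \<open>Symmetry of the binomial exchanges the lower index \<open>r\<close> for
        \<open>m - k + 1\<close>.\<close>
      then have "n - k - r = m - k + 1" "r \<le> n - k" using r by auto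
      then show "b_poly S k * q_binomial (n - k) r = b_poly S k * q_binomial (n - k) (m - k + 1)"
        by (metis q_binomial_symmetric)
    qed simp
    finally show ?thesis .
  qed
  moreover have slc: "slc (b_poly S)" unfolding b by (rule slc_last_poly) simp
  moreover have "strongly_q_log_concave m (b_poly S)"
    unfolding strongly_q_log_concave_def
  proof (intro conjI allI impI)
    show "no_internal_zeroes m (b_poly S)"
      unfolding no_internal_zeroes_def b using last_poly_no_internal_zeroes[OF m] by blast
    fix i j :: int assume ij: "i \<le> j"
    have nn: "nonneg_coeffs (zero_extend m (b_poly S) x)" for x
      by (simp add: zero_extend_def slc_nonneg[OF slc])
    show "nonneg_coeffs (zero_extend m (b_poly S) i * zero_extend m (b_poly S) j
                     - zero_extend m (b_poly S) (i - 1) * zero_extend m (b_poly S) (j + 1))"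
    proof (cases "1 \<le> i \<and> j + 1 \<le> int m")
      case True
      \<comment> \<open>These shifts translate integer indices into the natural ones of
        \<open>slc\<close>.\<close>
      define a c where "a = nat (i - 1)" and "c = nat (j - 1)"
      have "i = int (a + 1)" "j = int (c + 1)" "a \<le> c" "c + 2 \<le> m"
        using True ij by (auto simp: a_def c_def)
      then show ?thesis
        using slc unfolding slc_def zero_extend_def
        by (auto simp: nat_add_distrib)
    next
      case False
      \<comment> \<open>At the boundary \<open>i - 1\<close> is negative or \<open>j + 1\<close>
        exceeds \<open>m\<close>, so one factor is zero by extension.\<close>
      then have "zero_extend m (b_poly S) (i - 1) * zero_extend m (b_poly S) (j + 1) = 0"
        by (auto simp: zero_extend_def)
      then show ?thesis using nonneg_coeffs_mult[OF nn nn] by (metis diff_zero)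
    qed
  qed (rule slc_nonneg[OF slc])
  ultimately show ?thesis using slc_nonneg[OF slc] by blast
qed

end
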